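(* Let $F=(F_1,\dots,F_n)^T:\mathbb{R}^n\to\mathbb{R}^n$ be monotone, $L$-Lipschitz continuous, and componentwise Lipschitz continuous with constants $l_1,\dots,l_n>0$, and let $l_{\max}=\max_{1\le i\le n} l_i$. Let $\Omega\subseteq\mathbb{R}^n$ be nonempty, closed and convex, let $\boldsymbol{x}^*\in\Omega$ satisfy $F(\boldsymbol{x}^* )=\boldsymbol{0}$, and let $\rho\in(0,1)$. Let the sequences $\{\boldsymbol{x}_k\}$ and $\{\boldsymbol{y}_k\}$ be generated by the Greedy Mini-EG method (defined in the context) from an initial point $\boldsymbol{x}_0\in\mathbb{R}^n$. Then for any integer $K\ge 0$, $$\min_{0\le k\le K}\|F(\boldsymbol{x}_k)\|_\infty^2\;\le\;\frac{(\sqrt{n}\,l_{\max}+\rho L)^2}{\rho^2(1-\rho)^2(K+1)}\,\|\boldsymbol{x}_0-\boldsymbol{x}^*\|^2 .$$ In addition, $$\liminf_{k\to\infty}\|F(\boldsymbol{x}_k)\|_\infty=0 .$$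
   Context: $\|\cdot\|$ is the Euclidean norm, $\|\cdot\|_\infty$ the max norm, $e_i$ the $i$-th standard basis vector of $\mathbb{R}^n$, $P_\Omega$ the Euclidean projection onto $\Omega$. Monotone: $\langle F(\boldsymbol{x})-F(\boldsymbol{y}),\boldsymbol{x}-\boldsymbol{y}\rangle\ge0$ for all $\boldsymbol{x},\boldsymbol{y}\in\mathbb{R}^n$. $L$-Lipschitz continuous: $\|F(\boldsymbol{x})-F(\boldsymbol{y})\|\le L\|\boldsymbol{x}-\boldsymbol{y}\|$ for all $\boldsymbol{x},\boldsymbol{y}\in\mathbb{R}^n$. Componentwise Lipschitz continuous with constants $l_1,\dots,l_n>0$: $|F_i(\boldsymbol{x}+te_i)-F_i(\boldsymbol{x})|\le l_i|t|$ for all $i=1,\dots,n$, all $\boldsymbol{x}\in\mathbb{R}^n$ and all $t\in\mathbb{R}$. Greedy Mini-EG method: given $\boldsymbol{x}_0\in\mathbb{R}^n$, for $k=0,1,2,\dots$: $$i_k=\arg\max_{1\le i\le n}|F_i(\boldsymbol{x}_k)|,\qquad \boldsymbol{y}_k=\boldsymbol{x}_k-\frac{\rho}{l_{i_k}}F_{i_k}(\boldsymbol{x}_k)e_{i_k},\qquad \boldsymbol{x}_{k+1}=P_\Omega\big(\boldsymbol{x}_k-\beta_kF(\boldsymbol{y}_k)\big),$$ where $$\beta_k=\frac{F(\boldsymbol{y}_k)^T(\boldsymbol{x}_k-\boldsymbol{y}_k)}{\|F(\boldsymbol{y}_k)\|^2}.$$ *)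

theory Defs
  imports "HOL-Analysis.Analysis"
begin

definition monotone_operator :: "(real ^ 'n \<Rightarrow> real ^ 'n) \<Rightarrow> bool" where
  "monotone_operator F \<longleftrightarrow> (\<forall>x y. (F x - F y) \<bullet> (x - y) \<ge> 0)"

definition componentwise_lipschitz :: "('n \<Rightarrow> real) \<Rightarrow> (real ^ 'n \<Rightarrow> real ^ 'n) \<Rightarrow> bool" where
  "componentwise_lipschitz l F \<longleftrightarrow>
     (\<forall>i. l i > 0) \<and>
     (\<forall>i x t. \<bar>F (x + t *\<^sub>R axis i 1) $ i - F x $ i\<bar> \<le> l i * \<bar>t\<bar>)"

definition eg_trial ::
    "(real ^ 'n \<Rightarrow> real ^ 'n) \<Rightarrow> ('n \<Rightarrow> real) \<Rightarrow> real \<Rightarrow> 'n \<Rightarrow> real ^ 'n \<Rightarrow> real ^ 'n" where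
  "eg_trial F l \<rho> i x = x - (\<rho> / l i * (F x $ i)) *\<^sub>R axis i 1"

text \<open>If \<open>F y = 0\<close>, the quotient below is \<open>0\<close> by the convention on division. This choice is
  immaterial: the step size is only ever used as a factor of \<open>F y\<close>.\<close>

definition eg_stepsize ::
    "(real ^ 'n \<Rightarrow> real ^ 'n) \<Rightarrow> real ^ 'n \<Rightarrow> real ^ 'n \<Rightarrow> real" where
  "eg_stepsize F x y = (F y \<bullet> (x - y)) / (norm (F y))\<^sup>2"

text \<open>The sequences \<open>x\<close> and \<open>y\<close> are generated by the method from the initial point \<open>x 0\<close>, which
  need not lie in \<open>\<Omega>\<close>. The index chosen in each step is an arbitrary maximiser, so every rule for
  breaking ties is covered. For nonempty closed convex \<open>\<Omega>\<close>, \<^const>\<open>closest_point\<close> is the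
  Euclidean projection.\<close>

definition greedy_mini_eg ::
    "(real ^ 'n \<Rightarrow> real ^ 'n) \<Rightarrow> ('n \<Rightarrow> real) \<Rightarrow> real \<Rightarrow> (real ^ 'n) set \<Rightarrow>
     (nat \<Rightarrow> real ^ 'n) \<Rightarrow> (nat \<Rightarrow> real ^ 'n) \<Rightarrow> bool" where
  "greedy_mini_eg F l \<rho> \<Omega> x y \<longleftrightarrow>
     (\<forall>k. \<exists>i. is_arg_max (\<lambda>j. \<bar>F (x k) $ j\<bar>) (\<lambda>_. True) i \<and>
       y k = eg_trial F l \<rho> i (x k) \<and>
       x (Suc k) = closest_point \<Omega> (x k - eg_stepsize F (x k) (y k) *\<^sub>R F (y k)))"

end

theory Submission imports Defs begin

text \<open>Write \<open>x\<close>, \<open>y\<close> for a current and trial point, \<open>i\<close> for the chosen index and \<open>\<beta>\<close> for the step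
  size. Componentwise Lipschitz continuity along \<open>axis i 1\<close> keeps \<open>F y $ i\<close> within a factor
  \<open>1 - \<rho>\<close> of \<open>F x $ i\<close>, so \<open>F y \<bullet> (x - y) \<ge> \<rho> (1 - \<rho>) / l i * (infnorm (F x))\<^sup>2\<close>. By
  monotonicity the hyperplane through \<open>y\<close> normal to \<open>F y\<close> separates \<open>x\<close> from the zero \<open>xstar\<close>,
  and \<open>x - \<beta> *\<^sub>R F y\<close> is the projection of \<open>x\<close> onto it. Hence the squared distance to \<open>xstar\<close> drops by
  at least \<open>(F y \<bullet> (x - y) / norm (F y))\<^sup>2\<close>, which dominates a fixed multiple of
  \<open>(infnorm (F x))\<^sup>2\<close>. Summing over \<open>k\<close> gives both claims.\<close>

lemma infnorm_eq_arg_max: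
  fixes v :: "real ^ 'n"
  assumes "is_arg_max (\<lambda>j. \<bar>v $ j\<bar>) (\<lambda>_. True) i"
  shows "infnorm v = \<bar>v $ i\<bar>"
proof -
  have "\<bar>v $ j\<bar> \<le> \<bar>v $ i\<bar>" for j
    using assms by (auto simp: is_arg_max_def not_less)
  then have "infnorm v \<le> \<bar>v $ i\<bar>"
    unfolding infnorm_cart by (auto intro!: cSup_least)
  then show ?thesis
    using component_le_infnorm_cart[of v i] by linarith
qed

lemma eg_trial_inner_ge:
  assumes F: "componentwise_lipschitz l F" and "\<rho> > 0"
  shows "F (eg_trial F l \<rho> i x) \<bullet> (x - eg_trial F l \<rho> i x)
           \<ge> \<rho> * (1 - \<rho>) / l i * (F x $ i)\<^sup>2"
proof -
  define a b where "a = F x $ i" and "b = F (eg_trial F l \<rho> i x) $ i"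
  have l: "l i > 0"
    using F by (simp add: componentwise_lipschitz_def)
  \<comment> \<open>Taking \<open>t = - (\<rho> / l i * a)\<close> lands on the trial point; the
    factor \<open>1 / l i\<close> in the step cancels the Lipschitz constant.\<close>
  have "\<bar>F (x + (- (\<rho> / l i * a)) *\<^sub>R axis i 1) $ i - F x $ i\<bar> \<le> l i * \<bar>- (\<rho> / l i * a)\<bar>"
    using F unfolding componentwise_lipschitz_def by blast
  then have "\<bar>b - a\<bar> \<le> \<rho> * \<bar>a\<bar>"
    using l \<open>\<rho> > 0\<close> by (simp add: a_def b_def eg_trial_def abs_mult)
  then have "\<bar>a\<bar> * \<bar>b - a\<bar> \<le> \<bar>a\<bar> * (\<rho> * \<bar>a\<bar>)"
    by (intro mult_left_mono) auto
  then have "\<bar>a * (b - a)\<bar> \<le> \<rho> * a\<^sup>2"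
    by (simp add: abs_mult power2_eq_square mult_ac)
  then have "(1 - \<rho>) * a\<^sup>2 \<le> a * b"
    by (simp add: algebra_simps power2_eq_square abs_le_iff)
  then have "\<rho> / l i * ((1 - \<rho>) * a\<^sup>2) \<le> \<rho> / l i * (a * b)"
    using l \<open>\<rho> > 0\<close> by (intro mult_left_mono) auto
  \<comment> \<open>The displacement is a multiple of \<open>axis i 1\<close>, so only component
    \<open>i\<close> of \<open>F\<close> contributes.\<close>
  moreover have "F (eg_trial F l \<rho> i x) \<bullet> (x - eg_trial F l \<rho> i x) = \<rho> / l i * (a * b)"
    by (simp add: eg_trial_def[of F l \<rho> i x] inner_axis a_def b_def flip: eg_trial_def)
  ultimately show ?thesis
    by (simp add: a_def)
qed

text \<open>Controls the denominator of the decrease: the factor \<open>sqrt (real CARD('n))\<close>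
  compares the Euclidean norm with the max norm, and the other term is \<open>L\<close> times the
  length of the trial step.\<close>

lemma norm_eg_trial_le:
  fixes F :: "real ^ 'n \<Rightarrow> real ^ 'n"
  assumes "L-lipschitz_on UNIV F" and "l i > 0" and "\<rho> > 0"
  shows "norm (F (eg_trial F l \<rho> i x)) \<le> (sqrt (real CARD('n)) + \<rho> * L / l i) * infnorm (F x)"
proof -
  let ?y = "eg_trial F l \<rho> i x"
  have L: "L \<ge> 0"
    using assms(1) by (rule lipschitz_on_nonneg)
  have "norm (F ?y - F x) \<le> L * norm (?y - x)"
    using lipschitz_onD[OF assms(1), of ?y x] by (simp add: dist_norm)
  also have "\<dots> = \<rho> * L / l i * \<bar>F x $ i\<bar>"
    using assms(2,3) by (simp add: eg_trial_def abs_mult norm_axis_1)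
  also have "\<dots> \<le> \<rho> * L / l i * infnorm (F x)"
    using L assms(2,3) component_le_infnorm_cart[of "F x" i] by (intro mult_left_mono) auto
  finally have "norm (F ?y - F x) \<le> \<rho> * L / l i * infnorm (F x)" .
  moreover have "norm (F x) \<le> sqrt (real CARD('n)) * infnorm (F x)"
    using norm_le_infnorm[of "F x"] by simp
  moreover have "norm (F ?y) \<le> norm (F x) + norm (F ?y - F x)"
    using norm_triangle_ineq[of "F x" "F ?y - F x"] by simp
  ultimately show ?thesis
    by (simp add: distrib_right)
qed

text \<open>The projection is nonexpansive and fixes \<open>xstar\<close>. Expanding the square and
  replacing \<open>xstar\<close> by \<open>y\<close> through monotonicity leaves a quadratic in the
  step size, which \<open>eg_stepsize\<close> minimises when \<open>F y\<close> is nonzero.\<close>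

lemma eg_step_fejer:
  assumes mono: "monotone_operator F" and "F xstar = 0" and "xstar \<in> \<Omega>"
    and "closed \<Omega>" and "convex \<Omega>" and pos: "F y \<bullet> (x - y) \<ge> 0"
  shows "(norm (closest_point \<Omega> (x - eg_stepsize F x y *\<^sub>R F y) - xstar))\<^sup>2
           \<le> (norm (x - xstar))\<^sup>2 - (F y \<bullet> (x - y) / norm (F y))\<^sup>2"
proof -
  define \<beta> where "\<beta> = eg_stepsize F x y"
  have "dist (closest_point \<Omega> (x - \<beta> *\<^sub>R F y)) (closest_point \<Omega> xstar) \<le> dist (x - \<beta> *\<^sub>R F y) xstar"
    using assms(3-5) by (intro closest_point_lipschitz) auto
  then have "norm (closest_point \<Omega> (x - \<beta> *\<^sub>R F y) - xstar) \<le> norm ((x - xstar) - \<beta> *\<^sub>R F y)"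
    using \<open>xstar \<in> \<Omega>\<close> by (simp add: closest_point_self dist_norm algebra_simps)
  then have "(norm (closest_point \<Omega> (x - \<beta> *\<^sub>R F y) - xstar))\<^sup>2 \<le> (norm ((x - xstar) - \<beta> *\<^sub>R F y))\<^sup>2"
    by (intro power_mono) auto
  also have "\<dots> = (norm (x - xstar))\<^sup>2 - 2 * \<beta> * (F y \<bullet> (x - xstar)) + \<beta>\<^sup>2 * (norm (F y))\<^sup>2"
    unfolding power2_norm_eq_inner
    by (simp add: inner_diff_left inner_diff_right inner_commute power2_eq_square algebra_simps)
  also have "\<dots> \<le> (norm (x - xstar))\<^sup>2 - 2 * \<beta> * (F y \<bullet> (x - y)) + \<beta>\<^sup>2 * (norm (F y))\<^sup>2"
  proof -
    have "F y \<bullet> (y - xstar) \<ge> 0"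
      using mono \<open>F xstar = 0\<close> unfolding monotone_operator_def by (metis diff_zero)
    then have "F y \<bullet> (x - y) \<le> F y \<bullet> (x - xstar)"
      by (simp add: inner_diff_right)
    moreover have "\<beta> \<ge> 0"
      using pos by (simp add: \<beta>_def eg_stepsize_def)
    ultimately show ?thesis
      by (simp add: mult_left_mono)
  qed
  \<comment> \<open>If \<open>F y = 0\<close>, division by zero yields 0 and both sides reduce to
    the first term.\<close>
  also have "\<dots> = (norm (x - xstar))\<^sup>2 - (F y \<bullet> (x - y) / norm (F y))\<^sup>2"
    by (cases "F y = 0") (simp_all add: \<beta>_def eg_stepsize_def field_simps power2_eq_square)
  finally show ?thesis
    by (simp add: \<beta>_def)
qed

text \<open>A lower bound on \<open>p\<close> quadratic in the residual, divided by an upper bound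
  on \<open>norm (F (y k))\<close> linear in it, gives a decrease proportional to the squared
  residual.\<close>

lemma greedy_mini_eg_decrease:
  fixes F :: "real ^ 'n \<Rightarrow> real ^ 'n"
  assumes "monotone_operator F" and Lip: "L-lipschitz_on UNIV F"
    and comp: "componentwise_lipschitz l F"
    and "closed \<Omega>" and "convex \<Omega>" and "xstar \<in> \<Omega>" and "F xstar = 0"
    and \<rho>: "0 < \<rho>" "\<rho> < 1"
    and "greedy_mini_eg F l \<rho> \<Omega> x y"
  shows "(norm (x (Suc k) - xstar))\<^sup>2 \<le> (norm (x k - xstar))\<^sup>2
           - (\<rho> * (1 - \<rho>) / (sqrt (real CARD('n)) * Max (range l) + \<rho> * L) * infnorm (F (x k)))\<^sup>2"
proof -
  obtain i where i: "is_arg_max (\<lambda>j. \<bar>F (x k) $ j\<bar>) (\<lambda>_. True) i"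
    and y: "y k = eg_trial F l \<rho> i (x k)"
    and step: "x (Suc k) = closest_point \<Omega> (x k - eg_stepsize F (x k) (y k) *\<^sub>R F (y k))"
    using assms(10) unfolding greedy_mini_eg_def by blast
  define a where "a = infnorm (F (x k))"
  define p where "p = F (y k) \<bullet> (x k - y k)"
  let ?n = "sqrt (real CARD('n))"
  let ?D = "?n * Max (range l) + \<rho> * L"
  have l: "l i > 0"
    using comp by (simp add: componentwise_lipschitz_def)
  have L: "L \<ge> 0"
    using Lip by (rule lipschitz_on_nonneg)
  have a: "a \<ge> 0" "a\<^sup>2 = (F (x k) $ i)\<^sup>2"
    using infnorm_eq_arg_max[OF i] by (auto simp: a_def)
  have p: "p \<ge> \<rho> * (1 - \<rho>) / l i * a\<^sup>2"
    using eg_trial_inner_ge[OF comp \<rho>(1)] by (simp add: p_def y a)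
  have "\<rho> * (1 - \<rho>) / l i * a\<^sup>2 \<ge> 0"
    using \<rho> l by simp
  with p have p0: "p \<ge> 0"
    by linarith
  have nF: "norm (F (y k)) \<le> (?n + \<rho> * L / l i) * a"
    using norm_eg_trial_le[of L F l i \<rho> "x k"] Lip l \<rho> by (simp add: a_def y)
  have Di: "?n * l i + \<rho> * L > 0"
    using l L \<rho> by (intro add_pos_nonneg mult_pos_pos) auto
  \<comment> \<open>Passing to the largest constant makes the bound independent of the index chosen
    at step \<open>k\<close>.\<close>
  have D: "?n * l i + \<rho> * L \<le> ?D"
    by (simp add: mult_left_mono)
  with Di have D_pos: "?D > 0"
    by linarith
  have ratio: "\<rho> * (1 - \<rho>) / ?D * a \<le> p / norm (F (y k))"
  proof (cases "a = 0")
    case True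
    then show ?thesis
      using p0 by simp
  next
    case False
    then have a_pos: "a > 0"
      using a by simp
    have "\<rho> * (1 - \<rho>) / l i * a\<^sup>2 > 0"
      using \<rho> l a_pos by simp
    \<comment> \<open>Otherwise \<open>p\<close> would vanish, although its lower bound is
      positive.\<close>
    then have "F (y k) \<noteq> 0"
      using p by (auto simp: p_def)
    have "\<rho> * (1 - \<rho>) / ?D * a \<le> \<rho> * (1 - \<rho>) / (?n * l i + \<rho> * L) * a"
      using D Di D_pos \<rho> a by (intro mult_right_mono divide_left_mono mult_pos_pos) auto
    also have "\<dots> = (\<rho> * (1 - \<rho>) / l i * a\<^sup>2) / ((?n + \<rho> * L / l i) * a)"
    proof -
      have "?n + \<rho> * L / l i = (?n * l i + \<rho> * L) / l i"
        using l by (simp add: field_simps)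
      then show ?thesis
        using l a_pos Di by (simp add: power2_eq_square)
    qed
    also have "\<dots> \<le> p / norm (F (y k))"
      using p p0 nF \<open>F (y k) \<noteq> 0\<close> by (intro frac_le) auto
    finally show ?thesis .
  qed
  have "(norm (x (Suc k) - xstar))\<^sup>2 \<le> (norm (x k - xstar))\<^sup>2 - (p / norm (F (y k)))\<^sup>2"
    unfolding step p_def using assms p0 by (intro eg_step_fejer) (auto simp: p_def)
  moreover have "(\<rho> * (1 - \<rho>) / ?D * a)\<^sup>2 \<le> (p / norm (F (y k)))\<^sup>2"
    using ratio \<rho> a D_pos by (intro power_mono) auto
  ultimately show ?thesis
    by (simp add: a_def)
qed

theorem theorem3p7:
  fixes F :: "real ^ 'n \<Rightarrow> real ^ 'n"
    and l :: "'n \<Rightarrow> real"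
    and L \<rho> :: real
    and \<Omega> :: "(real ^ 'n) set"
    and xstar :: "real ^ 'n"
    and x y :: "nat \<Rightarrow> real ^ 'n"
  assumes "monotone_operator F"
    and "L-lipschitz_on UNIV F"
    and "componentwise_lipschitz l F"
    and "\<Omega> \<noteq> {}" and "closed \<Omega>" and "convex \<Omega>"
    and "xstar \<in> \<Omega>" and "F xstar = 0"
    and "0 < \<rho>" and "\<rho> < 1"
    and "greedy_mini_eg F l \<rho> \<Omega> x y"
  shows "(\<forall>K::nat. (MIN k\<in>{0..K}. (infnorm (F (x k)))\<^sup>2)
            \<le> (sqrt (real CARD('n)) * Max (range l) + \<rho> * L)\<^sup>2
                / (\<rho>\<^sup>2 * (1 - \<rho>)\<^sup>2 * (real K + 1)) * (norm (x 0 - xstar))\<^sup>2)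
         \<and> liminf (\<lambda>k. ereal (infnorm (F (x k)))) = 0"
proof -
  let ?n = "sqrt (real CARD('n))"
  define D where "D = ?n * Max (range l) + \<rho> * L"
  define a where "a k = infnorm (F (x k))" for k
  define c where "c = \<rho> * (1 - \<rho>) / D"
  define R where "R = (norm (x 0 - xstar))\<^sup>2"
  have "Max (range l) > 0"
    using assms(3) by (auto simp: componentwise_lipschitz_def Max_gr_iff)
  then have D: "D > 0"
    using assms lipschitz_on_nonneg[OF assms(2)] unfolding D_def
    by (intro add_pos_nonneg mult_pos_pos) auto
  then have c: "c > 0"
    using assms by (simp add: c_def)
  have "(norm (x (Suc k) - xstar))\<^sup>2 \<le> (norm (x k - xstar))\<^sup>2 - (c * a k)\<^sup>2" for k
    unfolding c_def D_def a_def
    using assms(1-3,5-11) by (rule greedy_mini_eg_decrease)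
  note decrease = this
  \<comment> \<open>The decreases telescope; the remaining distance is kept for the induction and
    dropped afterwards.\<close>
  have "(\<Sum>k<K. (c * a k)\<^sup>2) \<le> R - (norm (x K - xstar))\<^sup>2" for K
  proof (induction K)
    case (Suc K)
    then show ?case
      using decrease[of K] by simp
  qed (simp add: R_def)
  then have sum: "(\<Sum>k<K. (c * a k)\<^sup>2) \<le> R" for K
    using zero_le_power2 by (smt (verit))
  have "(MIN k\<in>{0..K}. (a k)\<^sup>2) \<le> D\<^sup>2 / (\<rho>\<^sup>2 * (1 - \<rho>)\<^sup>2 * (real K + 1)) * R" for K
  proof -
    define m where "m = (MIN k\<in>{0..K}. (a k)\<^sup>2)"
    \<comment> \<open>The minimum is at most the average of the \<open>K + 1\<close> terms with
      indices \<open>0\<close> to \<open>K\<close>.\<close>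
    have "(real K + 1) * (c\<^sup>2 * m) = (\<Sum>k<Suc K. c\<^sup>2 * m)"
      by simp
    also have "\<dots> \<le> (\<Sum>k<Suc K. (c * a k)\<^sup>2)"
      unfolding power_mult_distrib m_def
      by (intro sum_mono mult_left_mono Min_le) auto
    also have "\<dots> \<le> R"
      by (rule sum)
    finally have "m \<le> R / ((real K + 1) * c\<^sup>2)"
      using c by (simp add: pos_le_divide_eq mult_ac)
    also have "\<dots> = D\<^sup>2 / (\<rho>\<^sup>2 * (1 - \<rho>)\<^sup>2 * (real K + 1)) * R"
      by (simp add: c_def power_divide power_mult_distrib mult_ac)
    finally show ?thesis
      unfolding m_def .
  qed
  moreover have "liminf (\<lambda>k. ereal (a k)) = 0"
  proof -
    \<comment> \<open>Bounded partial sums force the terms to 0, so the residuals actually converge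
      and the limit inferior is their limit.\<close>
    have "summable (\<lambda>k. (c * a k)\<^sup>2)"
      using sum by (intro summableI_nonneg_bounded) auto
    then have "(\<lambda>k. (c * a k)\<^sup>2) \<longlonglongrightarrow> 0"
      by (rule summable_LIMSEQ_zero)
    then have "(\<lambda>k. c * a k) \<longlonglongrightarrow> 0"
      by simp
    then have "a \<longlonglongrightarrow> 0"
      using c by (simp add: tendsto_mult_left_iff[of c a 0, simplified])
    then have "(\<lambda>k. ereal (a k)) \<longlonglongrightarrow> 0"
      by (simp add: zero_ereal_def)
    then show ?thesis
      by (intro lim_imp_Liminf) auto
  qed
  ultimately show ?thesis
    unfolding a_def D_def R_def by blast
qed

end
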